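(* Let $G$ be a finite group with group operation written $a.b$, and define the sandwich product on $G$ by $ab = a.b^{-1}.a$. Then the sandwich product has the following properties: (LD) $(ab)(ac) = a(bc)$ for all $a,b,c \in G$; (II) $aa = a$ for all $a \in G$; (LI) $a(ab) = b$ for all $a,b \in G$; (LS) for all $a,b \in G$, if $ab = b$ then $ba = a$.
   Context: Juxtaposition denotes the sandwich product $ab = a.b^{-1}.a$; the dot denotes the group operation and $b^{-1}$ is the group inverse. *)

theory Defs
  imports "HOL-Algebra.Group"
begin

definition sandwich :: "('a, 'b) monoid_scheme \<Rightarrow> 'a \<Rightarrow> 'a \<Rightarrow> 'a"  (infixl "\<diamondop>\<index>" 70)
  where "a \<diamondop>\<^bsub>G\<^esub> b = a \<otimes>\<^bsub>G\<^esub> inv\<^bsub>G\<^esub> b \<otimes>\<^bsub>G\<^esub> a"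

end

theory Submission
  imports Defs
begin

text \<open>
  Inversion is an anti-automorphism of the group and the word \<open>a \<otimes> inv b \<otimes> a\<close> is a palindrome,
  so inversion is an automorphism of the sandwich product. Left distributivity,
  idempotence and left inversion then come down to free cancellation; for instance, both sides of
  left distributivity reduce to \<open>a \<otimes> inv b \<otimes> c \<otimes> inv b \<otimes> a\<close>.

  The last law needs one idea: \<open>a \<diamondop> b = b\<close> says that the quotient \<open>a \<otimes> inv b\<close> squares to the
  identity. Then its inverse \<open>b \<otimes> inv a\<close> does so too, and this is \<open>b \<diamondop> a = a\<close>.
\<close>

context group
begin

lemma inv_mult_cancel:
  assumes "x \<in> carrier G" "y \<in> carrier G"
  shows "inv x \<otimes> (x \<otimes> y) = y" and "x \<otimes> (inv x \<otimes> y) = y"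
  using assms by (simp_all add: m_assoc [symmetric])

lemma sandwich_closed:
  assumes "a \<in> carrier G" "b \<in> carrier G"
  shows "a \<diamondop> b \<in> carrier G"
  using assms by (simp add: sandwich_def)

lemma inv_sandwich:
  assumes "a \<in> carrier G" "b \<in> carrier G"
  shows "inv (a \<diamondop> b) = inv a \<diamondop> inv b"
  using assms by (simp add: sandwich_def inv_mult_group m_assoc)

lemma sandwich_left_distrib:
  assumes "a \<in> carrier G" "b \<in> carrier G" "c \<in> carrier G"
  shows "(a \<diamondop> b) \<diamondop> (a \<diamondop> c) = a \<diamondop> (b \<diamondop> c)"
proof -
  have "(a \<diamondop> b) \<diamondop> (a \<diamondop> c) = (a \<diamondop> b) \<otimes> (inv a \<diamondop> inv c) \<otimes> (a \<diamondop> b)"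
    using assms by (simp add: sandwich_def [of G "a \<diamondop> b" "a \<diamondop> c"] inv_sandwich)
  also have "\<dots> = a \<otimes> (inv b \<diamondop> inv c) \<otimes> a"
    using assms by (simp add: sandwich_def m_assoc inv_mult_cancel)
  also have "\<dots> = a \<diamondop> (b \<diamondop> c)"
    using assms by (simp add: sandwich_def [of G a "b \<diamondop> c"] inv_sandwich)
  finally show ?thesis .
qed

lemma sandwich_idem:
  assumes "a \<in> carrier G"
  shows "a \<diamondop> a = a"
  using assms by (simp add: sandwich_def)

lemma sandwich_left_inverse:
  assumes "a \<in> carrier G" "b \<in> carrier G"
  shows "a \<diamondop> (a \<diamondop> b) = b"
proof -
  have "a \<diamondop> (a \<diamondop> b) = a \<otimes> (inv a \<diamondop> inv b) \<otimes> a"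
    using assms by (simp add: sandwich_def [of G a "a \<diamondop> b"] inv_sandwich)
  also have "\<dots> = b"
    using assms by (simp add: sandwich_def m_assoc inv_mult_cancel)
  finally show ?thesis .
qed

text \<open>Multiplying \<open>a \<otimes> inv b \<otimes> a = b\<close> by \<open>inv b\<close> on the right exhibits the square of
  \<open>a \<otimes> inv b\<close>.\<close>

lemma sandwich_fixes_iff:
  assumes "a \<in> carrier G" "b \<in> carrier G"
  shows "a \<diamondop> b = b \<longleftrightarrow> (a \<otimes> inv b) \<otimes> (a \<otimes> inv b) = \<one>"
proof -
  have "a \<diamondop> b = b \<longleftrightarrow> (a \<diamondop> b) \<otimes> inv b = b \<otimes> inv b"
    using assms by (simp only: right_cancel sandwich_closed inv_closed)
  also have "\<dots> \<longleftrightarrow> (a \<otimes> inv b) \<otimes> (a \<otimes> inv b) = \<one>"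
    using assms by (simp add: sandwich_def m_assoc)
  finally show ?thesis .
qed

lemma sandwich_fixes_sym:
  assumes "a \<in> carrier G" "b \<in> carrier G" "a \<diamondop> b = b"
  shows "b \<diamondop> a = a"
proof -
  have "(a \<otimes> inv b) \<otimes> (a \<otimes> inv b) = \<one>"
    using assms sandwich_fixes_iff by blast
  then have "inv ((a \<otimes> inv b) \<otimes> (a \<otimes> inv b)) = \<one>"
    by simp
  then have "(b \<otimes> inv a) \<otimes> (b \<otimes> inv a) = \<one>"
    using assms by (simp add: inv_mult_group m_assoc)
  then show ?thesis
    using assms sandwich_fixes_iff by blast
qed

end

theorem proposition3p2:
  fixes G (structure)
  assumes "group G" and "finite (carrier G)"
  shows "(\<forall>a\<in>carrier G. \<forall>b\<in>carrier G. \<forall>c\<in>carrier G.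
            (a \<diamondop> b) \<diamondop> (a \<diamondop> c) = a \<diamondop> (b \<diamondop> c)) \<and>
         (\<forall>a\<in>carrier G. a \<diamondop> a = a) \<and>
         (\<forall>a\<in>carrier G. \<forall>b\<in>carrier G. a \<diamondop> (a \<diamondop> b) = b) \<and>
         (\<forall>a\<in>carrier G. \<forall>b\<in>carrier G. a \<diamondop> b = b \<longrightarrow> b \<diamondop> a = a)"
proof -
  interpret group G by fact
  show ?thesis
    by (simp add: sandwich_left_distrib sandwich_idem sandwich_left_inverse sandwich_fixes_sym)
qed

end
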